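(* Let $A\in[0,1]^{n\times n}$. For every $x\in[0,1]^n$ the sequence $\{A^{\otimes_L t}\otimes_L x\}_{t\ge1}$ and the sequence $\{A^{\otimes_L t}\}_{t\ge1}$ are ultimately periodic. If $\rho(A)<1$ they are ultimately zero. If $\rho(A)=1$, then (1) the ultimate period of $\{A^{\otimes_L t}\otimes_L x\}$ divides the cyclicity $\gamma$ of the critical graph of $A$, and (2) the ultimate period of $\{A^{\otimes_L t}\}$ equals $\gamma$.
   Context: $a\otimes_L b=\max(0,a+b-1)$, $(A\otimes_L B)_{ik}=\max_j\max(0,a_{ij}+b_{jk}-1)$; $A^{\otimes_L t}$ is the $t$-th max-Łukasiewicz power. $\rho(A)$ is the maximum cycle mean of $A$. The critical graph of $A$ consists of nodes and edges of the digraph of $A$ (edge $(i,j)$ of weight $a_{ij}$) lying on cycles of mean $\rho(A)$; its cyclicity $\gamma$ is the lcm, over its strongly connected components, of the gcd of the lengths of simple cycles in the component. A sequence $(y_t)$ is ultimately periodic if there are $T,p\ge1$ with $y_{t+p}=y_t$ for all $t\ge T$; its ultimate period is the least such $p$. *)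

theory Defs
  imports
    "HOL-Analysis.Analysis"
    "Graph_Theory.Digraph_Component"
    "Graph_Theory.Pair_Digraph"
begin

section \<open>Max-Lukasiewicz linear algebra\<close>

definition luk :: "real \<Rightarrow> real \<Rightarrow> real" where
  "luk a b = max 0 (a + b - 1)"

definition luk_mult :: "real^'m^'n \<Rightarrow> real^'k^'m \<Rightarrow> real^'k^'n" where
  "luk_mult A B = (\<chi> i k. MAX j. luk (A $ i $ j) (B $ j $ k))"

definition luk_mult_vec :: "real^'m^'n \<Rightarrow> real^'m \<Rightarrow> real^'n" where
  "luk_mult_vec A x = (\<chi> i. MAX j. luk (A $ i $ j) (x $ j))"

text \<open>The classical identity matrix \<^term>\<open>mat 1\<close> is also the neutral element of the
  max-Lukasiewicz product of matrices with entries in [0,1].\<close>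

primrec luk_power :: "real^'n^'n \<Rightarrow> nat \<Rightarrow> real^'n^'n" where
  "luk_power A 0 = mat 1"
| "luk_power A (Suc t) = luk_mult A (luk_power A t)"

lemma luk_mult_mat_1:
  fixes A :: "real^'m^'n"
  assumes "\<forall>i j. A $ i $ j \<in> {0..1}"
  shows "luk_mult A (mat 1) = A"
proof -
  have A: "0 \<le> A $ i $ j" "A $ i $ j \<le> 1" for i j using assms by auto
  have "(MAX j. luk (A $ i $ j) (mat 1 $ j $ k)) = A $ i $ k" for i :: 'n and k :: 'm
  proof (rule Max_eqI)
    show "A $ i $ k \<in> range (\<lambda>j. luk (A $ i $ j) (mat 1 $ j $ k))"
      by (rule image_eqI[of _ _ k]) (use A in \<open>auto simp: luk_def mat_def\<close>)
    show "y \<le> A $ i $ k" if "y \<in> range (\<lambda>j. luk (A $ i $ j) (mat 1 $ j $ k))" for y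
    proof -
      from that obtain j where "y = luk (A $ i $ j) (mat 1 $ j $ k)" by auto
      then show ?thesis
        using A(1)[of i k] A(2)[of i j] by (auto simp: luk_def mat_def split: if_splits)
    qed
  qed simp
  then show ?thesis by (simp add: luk_mult_def vec_eq_iff)
qed

lemma luk_power_1:
  fixes A :: "real^'n^'n"
  assumes "\<forall>i j. A $ i $ j \<in> {0..1}"
  shows "luk_power A 1 = A"
  using luk_mult_mat_1[OF assms] by simp


section \<open>Cycle means and the critical graph\<close>

text \<open>All entries of a matrix are finite, so that (as in max-plus algebra) every pair (i,j) is an
  edge, including those of weight 0.\<close>

definition matrix_digraph :: "real^'n^'n \<Rightarrow> 'n pair_pre_digraph" where
  "matrix_digraph A = \<lparr> pverts = UNIV, parcs = UNIV \<rparr>"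

definition edge_weight :: "real^'n^'n \<Rightarrow> 'n \<times> 'n \<Rightarrow> real" where
  "edge_weight A e = A $ fst e $ snd e"

text \<open>Cycles are nonempty closed walks, given by their lists of edges; a loop is a cycle of
  length 1.  Simple cycles are captured by \<^const>\<open>pre_digraph.cycle\<close>.\<close>

definition cycle_in :: "real^'n^'n \<Rightarrow> ('n \<times> 'n) awalk \<Rightarrow> bool" where
  "cycle_in A p \<longleftrightarrow> wf_digraph.closed_w (with_proj (matrix_digraph A)) p"

definition cycle_mean :: "real^'n^'n \<Rightarrow> ('n \<times> 'n) awalk \<Rightarrow> real" where
  "cycle_mean A p = (\<Sum>e\<leftarrow>p. edge_weight A e) / real (length p)"

text \<open>The supremum is attained, see \<open>max_cycle_mean_attained\<close> below.\<close>

definition max_cycle_mean :: "real^'n^'n \<Rightarrow> real" where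
  "max_cycle_mean A = Sup {cycle_mean A p | p. cycle_in A p}"

definition critical_cycle :: "real^'n^'n \<Rightarrow> ('n \<times> 'n) awalk \<Rightarrow> bool" where
  "critical_cycle A p \<longleftrightarrow> cycle_in A p \<and> cycle_mean A p = max_cycle_mean A"

definition critical_graph :: "real^'n^'n \<Rightarrow> 'n pair_pre_digraph" where
  "critical_graph A =
    \<lparr> pverts = {v. \<exists>p. critical_cycle A p \<and> v \<in> fst ` set p},
      parcs = {e. \<exists>p. critical_cycle A p \<and> e \<in> set p} \<rparr>"

definition cyclicity :: "('a, 'b) pre_digraph \<Rightarrow> nat" where
  "cyclicity G = (LCM C\<in>pre_digraph.sccs G. Gcd {length p | p. pre_digraph.cycle C p})"


section \<open>Ultimate periodicity\<close>

definition ultimate_period_of :: "(nat \<Rightarrow> 'a) \<Rightarrow> nat \<Rightarrow> bool" where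
  "ultimate_period_of y p \<longleftrightarrow> p \<ge> 1 \<and> (\<exists>T\<ge>1. \<forall>t\<ge>T. y (t + p) = y t)"

definition ultimately_periodic :: "(nat \<Rightarrow> 'a) \<Rightarrow> bool" where
  "ultimately_periodic y \<longleftrightarrow> (\<exists>p. ultimate_period_of y p)"

definition ultimate_period :: "(nat \<Rightarrow> 'a) \<Rightarrow> nat" where
  "ultimate_period y = (LEAST p. ultimate_period_of y p)"

definition ultimately_zero :: "(nat \<Rightarrow> 'a::zero) \<Rightarrow> bool" where
  "ultimately_zero y \<longleftrightarrow> (\<exists>T\<ge>1. \<forall>t\<ge>T. y t = 0)"


section \<open>The maximum cycle mean is attained\<close>

lemma pair_fin_matrix_digraph:
  fixes A :: "real^'n^'n"
  shows "pair_fin_digraph (matrix_digraph A)"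
  by unfold_locales (auto simp: matrix_digraph_def)

lemma max_cycle_mean_attained:
  fixes A :: "real^'n^'n"
  shows "\<exists>p. critical_cycle A p"
    and "\<And>p. cycle_in A p \<Longrightarrow> cycle_mean A p \<le> max_cycle_mean A"
proof -
  interpret pair_fin_digraph "matrix_digraph A" by (rule pair_fin_matrix_digraph)
  define S where "S = {p. cycle p}"
  define M where "M = Max (cycle_mean A ` S)"
  have "S \<subseteq> {p. set p \<subseteq> UNIV \<and> distinct p}"
    by (auto simp: S_def cycle_def intro: distinct_tl_verts_imp_distinct)
  then have fin: "finite S"
    by (rule finite_subset) (rule finite_subset_distinct[OF finite_class.finite_UNIV])
  have "cycle [(undefined, undefined)]"
    unfolding cycle_def awalk_def by (auto simp: matrix_digraph_def)
  then have ne: "S \<noteq> {}" by (auto simp: S_def)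
  have bound: "sum_list (map (edge_weight A) p) \<le> M * real (length p)" if "closed_w p" for p
    using that
  proof (induct "length p" arbitrary: p rule: less_induct)
    case less
    then obtain u where *: "awalk u p u" "p \<noteq> []" by (auto simp: closed_w_def)
    show ?case
    proof (cases "cycle p")
      case True
      then have "cycle_mean A p \<le> M"
        unfolding M_def by (intro Max_ge) (use fin in \<open>auto simp: S_def\<close>)
      then show ?thesis using * by (simp add: cycle_mean_def divide_le_eq)
    next
      case False
      then have nd: "\<not> distinct (tl (pawalk_verts u p))" using * by (auto simp: cycle_def)
      obtain e es where p: "p = e # es" using * by (cases p) auto
      have **: "awalk (snd e) es u" "\<not> distinct (pawalk_verts (snd e) es)"
        using nd * p by (auto simp: awalk_Cons_iff)
      obtain q r s w where d: "es = q @ r @ s" "awalk (snd e) q w" "awalk w s u" "closed_w r"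
        by (rule awalk_cyc_decompE'[OF **]) auto
      have "awalk u (e # q @ s) u"
        using d * p by (auto simp: awalk_Cons_iff)
      then have "closed_w (e # q @ s)" by (auto simp: closed_w_def)
      moreover have "length (e # q @ s) < length p" "length r < length p"
        using d p by (auto simp: closed_w_def)
      ultimately have "sum_list (map (edge_weight A) (e # q @ s)) \<le> M * real (length (e # q @ s))"
        "sum_list (map (edge_weight A) r) \<le> M * real (length r)"
        using less(1) d(4) by blast+
      then show ?thesis using p d(1)
        by (simp add: algebra_simps)
    qed
  qed
  have le: "cycle_mean A p \<le> M" if "cycle_in A p" for p
    using bound[of p] that by (auto simp: cycle_in_def cycle_mean_def divide_le_eq closed_w_def)
  have "M \<in> cycle_mean A ` S" unfolding M_def by (intro Max_in) (use fin ne in auto)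
  then obtain p where p: "cycle p" "M = cycle_mean A p" by (auto simp: S_def)
  have cp: "cycle_in A p" using p(1) unfolding cycle_in_def by (auto simp: cycle_altdef)
  have "max_cycle_mean A = M"
    unfolding max_cycle_mean_def by (rule cSup_eq_maximum) (use cp p le in auto)
  then show "\<exists>p. critical_cycle A p" "\<And>p. cycle_in A p \<Longrightarrow> cycle_mean A p \<le> max_cycle_mean A"
    using cp p le by (auto simp: critical_cycle_def)
qed

end

(* Entries of A^t are max 0 (1 - c), where c is the least cost of a walk of length t, an edge e
   costing 1 - a_e. Only finitely many costs are at most 1, so the powers take finitely many values
   and are ultimately periodic. A long walk of cost below 1 contains a closed walk of cost 0; there
   is none if the maximum cycle mean is below 1, and otherwise it lies in the critical graph, where
   closed walks of cost 0 can be inserted. By periodicity their lengths matter only modulo the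
   period, so one may insert length gamma, which gives A^t \<le> A^(t + gamma) for large t, hence
   equality. Conversely, A^t has diagonal entry 1 at a critical vertex only if the cyclicity of its
   component divides t. *)

theory Submission
  imports Defs "HOL-Number_Theory.Cong"
begin

section \<open>Periods\<close>

lemma ultimate_period_of_iterate:
  fixes y :: "nat \<Rightarrow> 'a"
  assumes "\<forall>t\<ge>T. y (t + p) = y t" "t \<ge> T"
  shows "y (t + k * p) = y t"
proof (induction k)
  case (Suc k)
  have "y (t + Suc k * p) = y (t + k * p + p)" by (simp add: algebra_simps)
  also have "\<dots> = y (t + k * p)" using assms by simp
  finally show ?case using Suc.IH by simp
qed simp

lemma ultimate_period_of_ultimate_period:
  assumes "ultimately_periodic y"
  shows "ultimate_period_of y (ultimate_period y)"
  using assms unfolding ultimately_periodic_def ultimate_period_def by (rule LeastI_ex)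

text \<open>Shifting by the remainder \<open>q mod p\<close> has the same eventual effect as
  shifting by \<open>q\<close>, because the other \<open>q div p\<close> multiples of
  \<open>p\<close> are absorbed. A nonzero remainder would be a period below the least one.\<close>

lemma ultimate_period_dvd:
  assumes q: "ultimate_period_of y q"
  shows "ultimate_period y dvd q"
proof -
  define p where "p = ultimate_period y"
  have "ultimate_period_of y p"
    using q unfolding p_def
    by (intro ultimate_period_of_ultimate_period) (auto simp: ultimately_periodic_def)
  then obtain T where p: "p \<ge> 1" "\<forall>t\<ge>T. y (t + p) = y t"
    by (auto simp: ultimate_period_of_def)
  obtain T' where q': "\<forall>t\<ge>T'. y (t + q) = y t"
    using q by (auto simp: ultimate_period_of_def)
  have "y (t + q mod p) = y t" if "t \<ge> max 1 (max T T')" for t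
  proof -
    have "y (t + q mod p) = y (t + q mod p + (q div p) * p)"
      using that by (intro ultimate_period_of_iterate[OF p(2), symmetric]) simp
    also have "\<dots> = y (t + q)" by (simp add: algebra_simps)
    also have "\<dots> = y t" using q' that by simp
    finally show ?thesis .
  qed
  then have "ultimate_period_of y (q mod p)" if "q mod p \<noteq> 0"
    unfolding ultimate_period_of_def using that by (auto intro!: exI[of _ "max 1 (max T T')"])
  then have "p \<le> q mod p" if "q mod p \<noteq> 0"
    using that unfolding p_def ultimate_period_def by (intro Least_le)
  moreover have "q mod p < p" using p(1) by simp
  ultimately have "q mod p = 0" by linarith
  then show ?thesis unfolding p_def by (rule mod_0_imp_dvd)
qed

lemma ultimate_period_of_image:
  "ultimate_period_of y p \<Longrightarrow> ultimate_period_of (\<lambda>t. f (y t)) p"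
  by (auto simp: ultimate_period_of_def)

text \<open>Modulo \<^term>\<open>p\<close> an additive submonoid of the naturals is a subgroup, hence contains
  its greatest common divisor.\<close>

lemma submonoid_represents_Gcd_multiple:
  fixes S :: "nat set"
  assumes zero: "0 \<in> S" and add: "\<And>a b. a \<in> S \<Longrightarrow> b \<in> S \<Longrightarrow> a + b \<in> S"
    and "p > 0" and g: "Gcd S dvd g"
  obtains s where "s \<in> S" "s \<ge> g" "[s = g] (mod p)"
proof -
  \<comment> \<open>\<open>H\<close> is an ideal of the integers: negative multiples exist because a
    coefficient may be replaced by its residue modulo \<open>p\<close>. Its least positive element
    \<open>d\<close> divides all of \<open>S\<close>, hence \<open>g\<close>, so \<open>g\<close>
    lies in \<open>H\<close>.\<close>
  define H where "H = {h::int. \<exists>s\<in>S. [int s = h] (mod int p)}"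
  have mult: "k * s \<in> S" if "s \<in> S" for k s
    using that by (induction k) (auto intro: zero add)
  have H_add: "a + b \<in> H" if ab: "a \<in> H" "b \<in> H" for a b
  proof -
    obtain s t where "s \<in> S" "[int s = a] (mod int p)" "t \<in> S" "[int t = b] (mod int p)"
      using ab unfolding H_def by blast
    then have "s + t \<in> S" "[int (s + t) = a + b] (mod int p)"
      by (auto intro: add cong_add)
    then show ?thesis unfolding H_def by blast
  qed
  have H_mult: "k * a \<in> H" if "a \<in> H" for a k
  proof -
    obtain s where s: "s \<in> S" "[int s = a] (mod int p)" using \<open>a \<in> H\<close> by (auto simp: H_def)
    have "[int (nat (k mod int p)) = k] (mod int p)" using \<open>p > 0\<close> by simp
    then have "[int (nat (k mod int p) * s) = k * a] (mod int p)"
      using s(2) unfolding of_nat_mult by (rule cong_mult)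
    then show ?thesis using mult[OF s(1)] unfolding H_def by blast
  qed
  have p_H: "int p \<in> H" using zero by (auto simp: H_def cong_def intro!: bexI[of _ 0])
  define d where "d = (LEAST n. n > 0 \<and> int n \<in> H)"
  have d: "d > 0" "int d \<in> H"
    using LeastI[of "\<lambda>n. n > 0 \<and> int n \<in> H" p] p_H \<open>p > 0\<close> unfolding d_def by auto
  have "d dvd s" if "s \<in> S" for s
  proof -
    have "int s \<in> H" unfolding H_def using that cong_refl by blast
    moreover have "int (s mod d) = int s + (- int (s div d)) * int d"
      by (simp add: zmod_int minus_div_mult_eq_mod[symmetric] zdiv_int)
    ultimately have "int (s mod d) \<in> H" using H_add H_mult d(2) by metis
    then have "s mod d = 0"
      using d(1) not_less_Least[of "s mod d" "\<lambda>n. n > 0 \<and> int n \<in> H"] by (auto simp: d_def[symmetric])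
    then show ?thesis by (rule mod_0_imp_dvd)
  qed
  then have "d dvd g" using g by (meson Gcd_greatest dvd_trans)
  then have "int g \<in> H" using H_mult[OF d(2)] by (metis dvd_def mult.commute of_nat_mult)
  then obtain s where s: "s \<in> S" "[s = g] (mod p)" by (auto simp: H_def cong_int_iff)
  show thesis
  proof (cases "S \<subseteq> {0}")
    case True
    then have "S = {0}" using zero by blast
    then have "g = 0" using g by simp
    then show ?thesis using s by (intro that) auto
  next
    case False
    then obtain m where m: "m \<in> S" "m > 0" by auto
    show ?thesis
    proof (rule that)
      \<comment> \<open>Adding \<open>p * g\<close> copies of a positive element \<open>m\<close>
        lifts the representative above \<open>g\<close> and keeps its residue.\<close>
      show "s + (p * g) * m \<in> S" using add mult s m by blast
      have "g \<le> p * g * m" using \<open>p > 0\<close> m(2) by simp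
      then show "g \<le> s + p * g * m" by (rule trans_le_add2)
      show "[s + p * g * m = g] (mod p)" using s(2) by (simp add: cong_def mult.assoc)
    qed
  qed
qed

section \<open>Cycle lengths in strongly connected components\<close>

context wf_digraph
begin

text \<open>A closed walk that is neither empty nor a simple cycle splits at a repeated vertex into
  two shorter closed walks, and lengths add.\<close>

lemma Gcd_cycles_dvd_closed_walk:
  assumes "awalk u p u"
  shows "Gcd {length c | c. cycle c} dvd length p"
  using assms
proof (induct "length p" arbitrary: u p rule: less_induct)
  case less
  show ?case
  proof (cases "cycle p \<or> p = []")
    case True
    then show ?thesis by (auto intro: Gcd_dvd)
  next
    case False
    then obtain e es where p: "p = e # es" by (cases p) auto
    \<comment> \<open>\<open>cycle\<close> asks for distinctness only of the tail of the vertex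
      list, so the first edge is removed before a repetition is sought.\<close>
    have es: "awalk (head G e) es u" "\<not> distinct (awalk_verts (head G e) es)"
      using False less.prems p by (auto simp: awalk_Cons_iff cycle_def)
    obtain q r s w where d: "es = q @ r @ s" "awalk (head G e) q w" "awalk w r w" "awalk w s u"
        "closed_w r"
      by (rule awalk_cyc_decompE'[OF es]) auto
    have "awalk u (e # q @ s) u"
      using d p less.prems by (auto simp: awalk_Cons_iff)
    moreover have "length (e # q @ s) < length p" "length r < length p"
      using d p by (auto simp: closed_w_def)
    ultimately have "Gcd {length c | c. cycle c} dvd length (e # q @ s)"
      "Gcd {length c | c. cycle c} dvd length r"
      using less.hyps d(3) by blast+
    then have "Gcd {length c | c. cycle c} dvd length (e # q @ s) + length r" by (rule dvd_add)
    then show ?thesis by (simp add: p d(1) ac_simps)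
  qed
qed

text \<open>Each vertex of a closed walk at \<open>v\<close> is reachable from \<open>v\<close> and
  reaches \<open>v\<close>.\<close>

lemma awalk_in_scc_of:
  assumes "awalk v p v"
  shows "pre_digraph.awalk (G \<restriction> scc_of v) v p v"
proof (rule awalk_induce[OF assms])
  show "set (awalk_verts v p) \<subseteq> scc_of v"
  proof
    fix w assume "w \<in> set (awalk_verts v p)"
    then obtain q r where "awalk v q w" "awalk w r v"
      using awalk_decomp[OF assms] by blast
    then show "w \<in> scc_of v" unfolding scc_of_def by (auto intro: reachable_awalkI)
  qed
qed

text \<open>One divisibility is the decomposition into simple cycles. For the other, a cycle of the
  component is inserted into a closed walk from \<open>v\<close> through one of its vertices; the
  lengths with and without it differ by the length of the cycle.\<close>

lemma Gcd_scc_cycles_eq_Gcd_closed_walks: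
  assumes "v \<in> verts G"
  shows "Gcd {length c | c. pre_digraph.cycle (G \<restriction> scc_of v) c}
    = Gcd {length p | p. awalk v p v}"
proof (rule dvd_antisym)
  interpret C: wf_digraph "G \<restriction> scc_of v" by auto
  show "Gcd {length c | c. C.cycle c} dvd Gcd {length p | p. awalk v p v}"
    by (rule Gcd_greatest) (use C.Gcd_cycles_dvd_closed_walk awalk_in_scc_of in blast)
  show "Gcd {length p | p. awalk v p v} dvd Gcd {length c | c. C.cycle c}" (is "?g dvd _")
  proof (rule Gcd_greatest)
    fix l assume "l \<in> {length c | c. C.cycle c}"
    then obtain c u where c: "l = length c" "C.awalk u c u" by (auto simp: C.cycle_def)
    have scc: "scc_of v \<subseteq> verts G"
      by (auto simp: scc_of_def reachable_in_verts)
    have "u \<in> scc_of v" using C.awalk_hd_in_verts[OF c(2)] by simp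
    then obtain q r where qr: "awalk v q u" "awalk u r v"
      by (auto simp: scc_of_def reachable_awalk)
    have c': "awalk u c u"
      using subgraph_awalk_imp_awalk[OF c(2) subgraph_induce_subgraphI[OF scc]] .
    have "awalk v (q @ r) v" "awalk v (q @ c @ r) v"
      using qr c' by (auto intro: awalk_appendI)
    then have "?g dvd length (q @ r)" "?g dvd length (q @ c @ r)"
      by (blast intro: Gcd_dvd)+
    moreover have "length (q @ c @ r) = length (q @ r) + l" by (simp add: c(1))
    ultimately show "?g dvd l" by (simp only: dvd_add_right_iff)
  qed
qed

text \<open>Lengths of closed walks at a fixed vertex form an additive monoid, unlike those of
  simple cycles. Running over vertices instead of components only repeats values in the lcm.\<close>

lemma cyclicity_eq_Lcm_closed_walks:
  "cyclicity G = (LCM v\<in>verts G. Gcd {length p | p. awalk v p v})"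
  by (simp add: cyclicity_def sccs_conv_sccs_verts sccs_verts_conv_scc_of image_image
      Gcd_scc_cycles_eq_Gcd_closed_walks cong: image_cong)

end

section \<open>Powers and walks\<close>

text \<open>Complementary weights make \<open>luk\<close> additive up to truncation:
  \<open>luk (1 - c) (1 - d) = max 0 (1 - (c + d))\<close>.\<close>

definition walk_cost :: "real^'n^'n \<Rightarrow> ('n \<times> 'n) list \<Rightarrow> real" where
  "walk_cost A p = (\<Sum>e\<leftarrow>p. 1 - edge_weight A e)"

lemma walk_cost_simps [simp]:
  "walk_cost A [] = 0"
  "walk_cost A (e # p) = 1 - edge_weight A e + walk_cost A p"
  "walk_cost A (p @ q) = walk_cost A p + walk_cost A q"
  by (simp_all add: walk_cost_def)

lemma walk_cost_eq_length_minus_weight: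
  "walk_cost A p = real (length p) - (\<Sum>e\<leftarrow>p. edge_weight A e)"
  by (induction p) auto

lemma pcas_append: "pcas u (p @ q) v \<longleftrightarrow> (\<exists>w. pcas u p w \<and> pcas w q v)"
  by (induction p arbitrary: u) auto

section \<open>Entries of powers as least costs of walks\<close>

locale unit_matrix =
  fixes A :: "real^'n^'n"
  assumes entries: "A $ i $ j \<in> {0..1}"
begin

abbreviation P :: "nat \<Rightarrow> 'n \<Rightarrow> 'n \<Rightarrow> real" where
  "P t i j \<equiv> luk_power A t $ i $ j"

lemma edge_weight_range: "0 \<le> edge_weight A e" "edge_weight A e \<le> 1"
  using entries by (auto simp: edge_weight_def)

lemma walk_cost_nonneg: "walk_cost A p \<ge> 0"
  unfolding walk_cost_def by (rule sum_list_nonneg) (auto simp: edge_weight_range)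

lemma walk_cost_eq_0_iff: "walk_cost A p = 0 \<longleftrightarrow> (\<forall>e\<in>set p. edge_weight A e = 1)"
proof (induction p)
  case (Cons e p)
  then show ?case using walk_cost_nonneg[of p] edge_weight_range[of e] by auto
qed simp

lemma luk_power_Suc_ge: "luk (A $ i $ k) (P t k j) \<le> P (Suc t) i j"
  by (simp add: luk_mult_def)

lemma luk_power_Suc_attained:
  obtains k where "P (Suc t) i j = luk (A $ i $ k) (P t k j)"
proof -
  have "P (Suc t) i j \<in> range (\<lambda>k. luk (A $ i $ k) (P t k j))"
    unfolding luk_power.simps luk_mult_def vec_lambda_beta by (rule Max_in) auto
  then show thesis using that by blast
qed

lemma luk_power_range: "0 \<le> P t i j \<and> P t i j \<le> 1"
proof (induction t arbitrary: i)
  case (Suc t)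
  obtain k where "P (Suc t) i j = luk (A $ i $ k) (P t k j)" by (rule luk_power_Suc_attained)
  then show ?case using entries[of i k] Suc.IH[of k] by (auto simp: luk_def)
qed (simp add: mat_def)

text \<open>Passing through \<open>v\<close> is one choice among those over which the power
  maximizes; associativity and monotonicity of \<open>luk\<close> carry the bound across the first
  step.\<close>

lemma luk_power_add_ge: "luk (P r i v) (P s v j) \<le> P (r + s) i j"
proof (induction r arbitrary: i)
  case 0
  show ?case using luk_power_range[of s v j] luk_power_range[of s i j] by (auto simp: mat_def luk_def)
next
  case (Suc r)
  obtain k where k: "P (Suc r) i v = luk (A $ i $ k) (P r k v)" by (rule luk_power_Suc_attained)
  have "luk (A $ i $ k) (P (r + s) k j) \<le> P (Suc r + s) i j"
    using luk_power_Suc_ge[of i k "r + s" j] by simp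
  moreover have "luk (luk (A $ i $ k) (P r k v)) (P s v j) \<le> luk (A $ i $ k) (P (r + s) k j)"
    using Suc.IH[of k] entries[of i k] luk_power_range[of s v j]
    by (auto simp: luk_def max_def split: if_splits)
  ultimately show ?case unfolding k by linarith
qed

lemma luk_power_ge_walk:
  assumes "pcas i p j"
  shows "1 - walk_cost A p \<le> P (length p) i j"
  using assms
proof (induction p arbitrary: i)
  case (Cons e p)
  then have "1 - walk_cost A p \<le> P (length p) (snd e) j" by simp
  then have "1 - walk_cost A (e # p) \<le> luk (A $ i $ snd e) (P (length p) (snd e) j)"
    using Cons.prems by (auto simp: luk_def edge_weight_def)
  also have "\<dots> \<le> P (length (e # p)) i j" using luk_power_Suc_ge by simp
  finally show ?case .
qed (simp add: mat_def)

text \<open>A positive entry was not truncated at any step, so the maximizing indices form a walk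
  whose costs add up exactly.\<close>

lemma luk_power_pos_walk:
  assumes "P t i j > 0"
  obtains p where "pcas i p j" "length p = t" "P t i j = 1 - walk_cost A p"
proof -
  have "\<exists>p. pcas i p j \<and> length p = t \<and> P t i j = 1 - walk_cost A p"
    using assms
  proof (induction t arbitrary: i)
    case 0
    then show ?case by (auto simp: mat_def split: if_splits)
  next
    case (Suc t)
    obtain k where k: "P (Suc t) i j = luk (A $ i $ k) (P t k j)" by (rule luk_power_Suc_attained)
    then have "P t k j > 0" using Suc.prems entries[of i k] by (auto simp: luk_def)
    then obtain p where p: "pcas k p j" "length p = t" "P t k j = 1 - walk_cost A p"
      using Suc.IH by blast
    have "P (Suc t) i j = 1 - walk_cost A ((i, k) # p)"
      using k Suc.prems p(3) by (auto simp: luk_def edge_weight_def max_def split: if_splits)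
    then show ?case using p by (intro exI[of _ "(i, k) # p"]) auto
  qed
  then show thesis using that by blast
qed

lemma luk_power_eq_1_iff:
  "P t i j = 1 \<longleftrightarrow> (\<exists>p. pcas i p j \<and> length p = t \<and> (\<forall>e\<in>set p. edge_weight A e = 1))"
proof
  assume "P t i j = 1"
  then have "P t i j > 0" by simp
  then show "\<exists>p. pcas i p j \<and> length p = t \<and> (\<forall>e\<in>set p. edge_weight A e = 1)"
    using \<open>P t i j = 1\<close> by (elim luk_power_pos_walk) (auto simp: walk_cost_eq_0_iff[symmetric])
next
  assume "\<exists>p. pcas i p j \<and> length p = t \<and> (\<forall>e\<in>set p. edge_weight A e = 1)"
  then obtain p where "pcas i p j" "length p = t" "walk_cost A p = 0"
    using walk_cost_eq_0_iff by blast
  then show "P t i j = 1"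
    using luk_power_ge_walk[of i p j] luk_power_range[of t i j] by simp
qed

section \<open>Finitely many powers and ultimate periodicity\<close>

text \<open>Edges of cost 0 do not contribute, and only boundedly many of the others fit into a walk of
  cost at most 1.\<close>

lemma finite_walk_costs: "finite {walk_cost A p | p. walk_cost A p \<le> 1}"
proof -
  \<comment> \<open>The least positive edge cost; the inserted 1 keeps the set nonempty when all
    weights are 1.\<close>
  define d where "d = Min (insert 1 {1 - edge_weight A e | e. edge_weight A e < 1})"
  have fin: "finite {1 - edge_weight A e | e. edge_weight A e < 1}"
    by (rule finite_image_set) simp
  have "d > 0" unfolding d_def using fin by (subst Min_gr_iff) auto
  have d_le: "d \<le> 1 - edge_weight A e" if "edge_weight A e < 1" for e
    unfolding d_def using that fin by (intro Min_le) blast+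
  define K where "K = nat \<lfloor>1 / d\<rfloor>"
  \<comment> \<open>\<open>pos p\<close> need not be a walk, which is harmless since
    \<open>walk_cost\<close> is defined for arbitrary edge lists.\<close>
  define pos where "pos = filter (\<lambda>e. edge_weight A e < 1)"
  have cost_pos: "walk_cost A (pos p) = walk_cost A p" for p
  proof (induction p)
    case (Cons e p)
    then show ?case using edge_weight_range(2)[of e] by (auto simp: pos_def)
  qed (simp add: pos_def)
  have cost_ge: "real (length (pos p)) * d \<le> walk_cost A p" for p
  proof (induction p)
    case (Cons e p)
    then show ?case using edge_weight_range(2)[of e] d_le[of e] by (auto simp: pos_def algebra_simps)
  qed (simp add: pos_def)
  have "length (pos p) \<le> K" if "walk_cost A p \<le> 1" for p
  proof -
    have "real (length (pos p)) \<le> 1 / d"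
      using cost_ge[of p] that \<open>d > 0\<close> by (simp add: field_simps)
    then show ?thesis unfolding K_def by linarith
  qed
  then have "{walk_cost A p | p. walk_cost A p \<le> 1} \<subseteq> walk_cost A ` {p. set p \<subseteq> UNIV \<and> length p \<le> K}"
    using cost_pos by (force intro: image_eqI[of _ _ "pos _"])
  then show ?thesis
    by (rule finite_subset) (intro finite_imageI finite_lists_length_le, simp)
qed

lemma finite_range_luk_power: "finite (range (luk_power A))"
proof -
  define V where "V = insert 0 ((\<lambda>c. 1 - c) ` {walk_cost A p | p. walk_cost A p \<le> 1})"
  have "finite V" using finite_walk_costs by (simp add: V_def)
  have "P t i j \<in> V" for t i j
  proof (cases "P t i j > 0")
    case True
    then obtain p where "P t i j = 1 - walk_cost A p" by (rule luk_power_pos_walk)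
    moreover from this have "walk_cost A p \<le> 1" using luk_power_range[of t i j] by simp
    ultimately show ?thesis by (auto simp: V_def)
  next
    case False
    then have "P t i j = 0" using luk_power_range[of t i j] by linarith
    then show ?thesis by (simp add: V_def)
  qed
  then have "range (luk_power A) \<subseteq> (\<lambda>f. \<chi> i j. f (i, j)) ` (UNIV \<rightarrow>\<^sub>E V)"
    by (auto intro!: image_eqI[of _ _ "\<lambda>(i, j). P _ i j"] simp: vec_eq_iff PiE_iff)
  then show ?thesis
    by (rule finite_subset) (intro finite_imageI finite_PiE, use \<open>finite V\<close> in auto)
qed

text \<open>Two powers coincide because there are finitely many, and each power determines the
  next.\<close>

lemma luk_power_ultimately_periodic: "ultimately_periodic (luk_power A)"
proof -
  have "\<not> inj (luk_power A)"
    using finite_range_luk_power by (metis finite_imageD infinite_UNIV_nat)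
  then obtain a b where "a < b" "luk_power A a = luk_power A b"
    by (metis injI linorder_neqE_nat)
  have "luk_power A (t + (b - a)) = luk_power A t" if "t \<ge> a" for t
    using that
  proof (induction t rule: dec_induct)
    case base
    then show ?case using \<open>a < b\<close> \<open>luk_power A a = luk_power A b\<close> by simp
  qed simp
  then have "\<forall>t\<ge>max 1 a. luk_power A (t + (b - a)) = luk_power A t" by auto
  then show ?thesis
    using \<open>a < b\<close> unfolding ultimately_periodic_def ultimate_period_of_def
    by (metis max.cobounded1 zero_less_diff less_eq_Suc_le One_nat_def)
qed

section \<open>Return times and recurrent vertices\<close>

text \<open>By \<open>luk_power_eq_1_iff\<close> these are the lengths of closed walks at
  \<open>v\<close> along edges of weight 1, including the empty walk.\<close>

definition return_times :: "'n \<Rightarrow> nat set" where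
  "return_times v = {m. P m v v = 1}"

lemma return_times_0: "0 \<in> return_times v"
  by (simp add: return_times_def mat_def)

lemma return_times_add:
  assumes "a \<in> return_times v" "b \<in> return_times v"
  shows "a + b \<in> return_times v"
  using assms luk_power_add_ge[of a v v b v] luk_power_range[of "a + b" v v]
  by (auto simp: return_times_def luk_def)

text \<open>For maximum cycle mean 1 these are the critical vertices, see
  \<open>pverts_critical_graph\<close>. The bound on \<open>m\<close> excludes the empty
  walk.\<close>

definition recurrent :: "'n set" where
  "recurrent = {v. \<exists>m\<ge>1. m \<in> return_times v}"

text \<open>Along a walk of cost less than 1, the pairs of current vertex and cost so far take boundedly
  many values, so a long walk repeats a pair and thus contains a closed walk of cost 0.\<close>

lemma luk_power_via_recurrent:
  obtains T where "\<And>t i j. t \<ge> T \<Longrightarrow> P t i j > 0 \<Longrightarrow>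
    \<exists>r s. \<exists>v\<in>recurrent. t = r + s \<and> P t i j \<le> luk (P r i v) (P s v j)"
proof -
  define F where "F = {walk_cost A p | p. walk_cost A p \<le> 1}"
  define T where "T = card (UNIV \<times> F :: ('n \<times> real) set)"
  have fin: "finite (UNIV \<times> F :: ('n \<times> real) set)"
    using finite_walk_costs by (simp add: F_def)
  have "\<exists>r s. \<exists>v\<in>recurrent. t = r + s \<and> P t i j \<le> luk (P r i v) (P s v j)"
    if t: "t \<ge> T" "P t i j > 0" for t i j
  proof -
    obtain p where p: "pcas i p j" "length p = t" "P t i j = 1 - walk_cost A p"
      using t(2) by (rule luk_power_pos_walk)
    have "\<exists>w. pcas i (take k p) w \<and> pcas w (drop k p) j" for k
      using p(1) by (metis append_take_drop_id pcas_append)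
    then obtain w where w: "\<And>k. pcas i (take k p) (w k)" "\<And>k. pcas (w k) (drop k p) j" by metis
    define f where "f k = (w k, walk_cost A (take k p))" for k
    have "walk_cost A (take k p) \<le> walk_cost A p" for k
      using walk_cost_simps(3)[of A "take k p" "drop k p"] walk_cost_nonneg[of "drop k p"] by simp
    then have "walk_cost A (take k p) \<le> 1" for k
      using p(3) t(2) by (smt (verit))
    then have "f ` {..t} \<subseteq> UNIV \<times> F" by (auto simp: f_def F_def)
    then have "card (f ` {..t}) \<le> T" unfolding T_def by (rule card_mono[OF fin])
    \<comment> \<open>The \<open>t + 1\<close> positions on the walk exceed the at most
      \<open>T\<close> available pairs.\<close>
    then have "\<not> inj_on f {..t}" using t(1) by (auto dest: card_image)
    then obtain k l where kl: "k < l" "l \<le> t" "f k = f l"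
      unfolding inj_on_def by (metis atMost_iff linorder_neqE_nat)
    define c where "c = drop k (take l p)"
    define v where "v = w k"
    have take_l: "take l p = take k p @ c"
      using kl(1) unfolding c_def
      by (metis append_take_drop_id less_imp_le min.absorb1 take_take)
    have drop_k: "drop k p = c @ drop l p"
      unfolding c_def using kl(1,2) p(2)
      by (metis append_take_drop_id append.assoc same_append_eq take_l c_def)
    have pcas_eq: "x = y" if "pcas u q x" "pcas u q y" for u q x y
      using that by (induction q arbitrary: u) auto
    obtain x where x: "pcas i (take k p) x" "pcas x c (w l)"
      using w(1)[of l] unfolding take_l pcas_append by blast
    have "x = w k" using x(1) w(1) by (rule pcas_eq)
    then have "pcas v c v" using x(2) kl(3) by (simp add: v_def f_def)
    moreover have "walk_cost A c = 0" using kl(3) take_l by (simp add: f_def)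
    moreover have "length c \<ge> 1" using kl p(2) by (simp add: c_def)
    ultimately have v: "v \<in> recurrent"
      unfolding recurrent_def return_times_def luk_power_eq_1_iff walk_cost_eq_0_iff by blast
    \<comment> \<open>The walk is cut only at \<open>v\<close>; the closed walk \<open>c\<close>
      stays in the second part and merely certifies that \<open>v\<close> is recurrent.\<close>
    have "1 - walk_cost A (take k p) \<le> P k i v"
      using luk_power_ge_walk[OF w(1)[of k]] kl p(2) by (simp add: v_def)
    moreover have "1 - walk_cost A (drop k p) \<le> P (t - k) v j"
      using luk_power_ge_walk[OF w(2)[of k]] p(2) by (simp add: v_def)
    moreover have "walk_cost A p = walk_cost A (take k p) + walk_cost A (drop k p)"
      by (metis append_take_drop_id walk_cost_simps(3))
    ultimately have "P t i j \<le> luk (P k i v) (P (t - k) v j)"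
      using p(3) by (simp add: luk_def)
    moreover have "t = k + (t - k)" using kl by simp
    ultimately show ?thesis using v by blast
  qed
  then show thesis using that by blast
qed

lemma luk_power_ultimately_zero:
  assumes "recurrent = {}"
  shows "ultimately_zero (luk_power A)"
proof -
  obtain T where T: "\<And>t i j. t \<ge> T \<Longrightarrow> P t i j > 0 \<Longrightarrow>
    \<exists>r s. \<exists>v\<in>recurrent. t = r + s \<and> P t i j \<le> luk (P r i v) (P s v j)"
    by (rule luk_power_via_recurrent) blast
  have "P t i j = 0" if "t \<ge> T" for t i j
    using T[OF that, of i j] luk_power_range[of t i j] assms by force
  then have "\<forall>t\<ge>max 1 T. luk_power A t = 0" by (simp add: vec_eq_iff)
  then show ?thesis unfolding ultimately_zero_def by (meson max.cobounded1)
qed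

section \<open>The period of the powers\<close>

text \<open>The cyclicity of the critical graph in terms of powers, see
  \<open>cyclicity_critical_graph\<close>. Without recurrent vertices it is the empty lcm 1, a
  period of an ultimately zero sequence.\<close>

definition return_gcd_lcm :: nat where
  "return_gcd_lcm = (LCM v\<in>recurrent. Gcd (return_times v))"

lemma return_gcd_lcm_pos: "return_gcd_lcm > 0"
proof -
  have "Gcd (return_times v) \<noteq> 0" if "v \<in> recurrent" for v
    using that by (auto simp: recurrent_def)
  then have "return_gcd_lcm \<noteq> 0" unfolding return_gcd_lcm_def by (subst Lcm_0_iff) auto
  then show ?thesis by simp
qed

text \<open>Inserting closed walks of cost 0 gives the inequality \<open>P t i j \<le> P (t + g) i j\<close> for large
  \<open>t\<close>; periodicity turns it into an equality.\<close>

lemma ultimate_period_of_luk_power: "ultimate_period_of (luk_power A) return_gcd_lcm"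
proof -
  define g where "g = return_gcd_lcm"
  obtain p T\<^sub>1 where p: "p \<ge> 1" "\<forall>t\<ge>T\<^sub>1. luk_power A (t + p) = luk_power A t"
    using luk_power_ultimately_periodic
    by (auto simp: ultimately_periodic_def ultimate_period_of_def)
  obtain T\<^sub>2 where T\<^sub>2: "\<And>t i j. t \<ge> T\<^sub>2 \<Longrightarrow> P t i j > 0 \<Longrightarrow>
    \<exists>r s. \<exists>v\<in>recurrent. t = r + s \<and> P t i j \<le> luk (P r i v) (P s v j)"
    by (rule luk_power_via_recurrent) blast
  define T where "T = max 1 (max T\<^sub>1 T\<^sub>2)"
  have mono: "P t i j \<le> P (t + g) i j" if "t \<ge> T" for t i j
  proof (cases "P t i j > 0")
    case False
    then show ?thesis using luk_power_range[of "t + g" i j] by linarith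
  next
    case True
    have "t \<ge> T\<^sub>1" "t \<ge> T\<^sub>2" using that by (auto simp: T_def)
    obtain r s v where v: "v \<in> recurrent" "t = r + s" "P t i j \<le> luk (P r i v) (P s v j)"
      using T\<^sub>2[OF \<open>t \<ge> T\<^sub>2\<close> True] by blast
    have "Gcd (return_times v) dvd g"
      unfolding g_def return_gcd_lcm_def using v(1) by (intro dvd_Lcm) auto
    \<comment> \<open>\<open>g\<close> itself may fail to be a return time of \<open>v\<close>, but
      some return time \<open>m\<close> agrees with it modulo the period \<open>p\<close>, and the
      excess \<open>m - g\<close> is absorbed by periodicity.\<close>
    then obtain m where m: "m \<in> return_times v" "m \<ge> g" "[m = g] (mod p)"
      by (rule submonoid_represents_Gcd_multiple[rotated 3])
        (use return_times_0 return_times_add p(1) in auto)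
    have "P s v j \<le> P (m + s) v j"
      using luk_power_add_ge[of m v v s j] m(1) by (simp add: return_times_def luk_def)
    then have "luk (P r i v) (P s v j) \<le> luk (P r i v) (P (m + s) v j)" by (simp add: luk_def)
    also have "\<dots> \<le> P (r + (m + s)) i j" by (rule luk_power_add_ge)
    also have "r + (m + s) = t + g + ((m - g) div p) * p"
    proof -
      have "p dvd m - g" using m(2,3) by (simp add: cong_altdef_nat)
      then show ?thesis using v(2) m(2) by simp
    qed
    also have "luk_power A (t + g + ((m - g) div p) * p) = luk_power A (t + g)"
      using \<open>t \<ge> T\<^sub>1\<close> by (intro ultimate_period_of_iterate[OF p(2)]) simp
    finally show ?thesis using v(3) by linarith
  qed
  have "luk_power A (t + g) = luk_power A t" if "t \<ge> T" for t
  proof -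
    \<comment> \<open>After \<open>p\<close> increases by \<open>g\<close> the exponent has grown by
      \<open>g * p\<close>, a multiple of the period, so the chain of inequalities closes
      up.\<close>
    have chain: "P (t + g) i j \<le> P (t + g + k * g) i j" for i j k
    proof (induction k)
      case (Suc k)
      have "P (t + g + k * g) i j \<le> P (t + g + k * g + g) i j" using that by (intro mono) simp
      then show ?case using Suc.IH by (simp add: algebra_simps)
    qed simp
    have "t + g + (p - 1) * g = t + g * p" using p(1) by (cases p) (auto simp: algebra_simps)
    moreover have "luk_power A (t + g * p) = luk_power A t"
      using that by (intro ultimate_period_of_iterate[OF p(2)]) (simp add: T_def)
    ultimately have "P (t + g) i j \<le> P t i j" for i j using chain[of i j "p - 1"] by metis
    then show ?thesis using mono[OF that] by (auto simp: vec_eq_iff intro: antisym)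
  qed
  then have "\<forall>t\<ge>T. luk_power A (t + g) = luk_power A t" by blast
  moreover have "T \<ge> 1" by (simp add: T_def)
  ultimately show ?thesis
    using return_gcd_lcm_pos unfolding ultimate_period_of_def g_def by auto
qed

text \<open>A large return time stays a return time after adding \<open>p\<close>, so the gcd of the
  return times divides the difference \<open>p\<close>.\<close>

lemma return_gcd_lcm_dvd_period:
  assumes "ultimate_period_of (luk_power A) p"
  shows "return_gcd_lcm dvd p"
  unfolding return_gcd_lcm_def
proof (rule Lcm_least)
  fix d assume "d \<in> (\<lambda>v. Gcd (return_times v)) ` recurrent"
  then obtain v m where d: "d = Gcd (return_times v)" and m: "m \<ge> 1" "m \<in> return_times v"
    by (auto simp: recurrent_def)
  obtain T where T: "\<forall>t\<ge>T. luk_power A (t + p) = luk_power A t"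
    using assms by (auto simp: ultimate_period_of_def)
  \<comment> \<open>A multiple of the positive return time \<open>m\<close> that lies beyond the
    threshold \<open>T\<close>.\<close>
  have Tm: "T * m \<in> return_times v"
    by (induction T) (auto intro: return_times_0 return_times_add m)
  moreover have "T * m \<ge> T" using m(1) by simp
  ultimately have "T * m + p \<in> return_times v" using T by (simp add: return_times_def)
  then show "d dvd p" using Tm unfolding d by (metis Gcd_dvd dvd_add_right_iff)
qed

section \<open>The critical graph\<close>

text \<open>Every pair is an edge of the digraph of \<open>A\<close>, so only the fitting of
  consecutive edges remains.\<close>

lemma cycle_in_iff: "cycle_in A p \<longleftrightarrow> p \<noteq> [] \<and> (\<exists>u. pcas u p u)"
proof -
  interpret pair_fin_digraph "matrix_digraph A" by (rule pair_fin_matrix_digraph)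
  have "pverts (matrix_digraph A) = UNIV" "parcs (matrix_digraph A) = UNIV"
    by (simp_all add: matrix_digraph_def)
  then show ?thesis by (auto simp: cycle_in_def closed_w_def awalk_def)
qed

lemma cycle_mean_eq_1_iff:
  assumes "p \<noteq> []"
  shows "cycle_mean A p = 1 \<longleftrightarrow> (\<forall>e\<in>set p. edge_weight A e = 1)"
  using assms walk_cost_eq_length_minus_weight[of A p]
  by (auto simp: cycle_mean_def walk_cost_eq_0_iff[symmetric] divide_eq_eq)

lemma recurrent_iff_cycle: "v \<in> recurrent \<longleftrightarrow> (\<exists>p. p \<noteq> [] \<and> pcas v p v \<and> cycle_mean A p = 1)"
  unfolding recurrent_def return_times_def luk_power_eq_1_iff mem_Collect_eq
  by (metis One_nat_def Suc_leI cycle_mean_eq_1_iff length_greater_0_conv less_eq_Suc_le)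

text \<open>A recurrent vertex would lie on a cycle of mean 1, above the maximum.\<close>

lemma recurrent_empty:
  assumes "max_cycle_mean A < 1"
  shows "recurrent = {}"
proof -
  have "v \<notin> recurrent" for v
    using assms max_cycle_mean_attained(2)[of A] unfolding recurrent_iff_cycle
    by (metis cycle_in_iff not_le)
  then show ?thesis by blast
qed

context
  assumes mean: "max_cycle_mean A = 1"
begin

lemma critical_cycle_iff:
  "critical_cycle A p \<longleftrightarrow> p \<noteq> [] \<and> (\<exists>u. pcas u p u) \<and> (\<forall>e\<in>set p. edge_weight A e = 1)"
  unfolding critical_cycle_def mean cycle_in_iff using cycle_mean_eq_1_iff by blast

lemma pverts_critical_graph: "pverts (critical_graph A) = recurrent"
proof (intro equalityI subsetI)
  fix v assume "v \<in> pverts (critical_graph A)"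
  then obtain p u e where p: "pcas u p u" "\<forall>e\<in>set p. edge_weight A e = 1"
    and e: "e \<in> set p" "v = fst e"
    by (auto simp: critical_graph_def critical_cycle_iff)
  obtain q r where qr: "p = q @ e # r" using e(1) by (meson split_list)
  \<comment> \<open>The critical cycle is rotated so as to start at \<open>v\<close>.\<close>
  then have "pcas v (e # r @ q) v" using p(1) e(2) by (auto simp: pcas_append)
  moreover have "cycle_mean A (e # r @ q) = 1"
    using p(2) qr by (subst cycle_mean_eq_1_iff) auto
  ultimately show "v \<in> recurrent" unfolding recurrent_iff_cycle by blast
next
  fix v assume "v \<in> recurrent"
  then obtain p where p: "p \<noteq> []" "pcas v p v" "cycle_mean A p = 1"
    by (auto simp: recurrent_iff_cycle)
  then have "critical_cycle A p" "v = fst (hd p)" "hd p \<in> set p"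
    by (cases p; auto simp: critical_cycle_iff cycle_mean_eq_1_iff)+
  then show "v \<in> pverts (critical_graph A)" by (auto simp: critical_graph_def)
qed

lemma pair_fin_critical_graph: "pair_fin_digraph (critical_graph A)"
proof
  fix e assume "e \<in> parcs (critical_graph A)"
  then obtain p u where p: "critical_cycle A p" "pcas u p u" "e \<in> set p"
    by (auto simp: critical_graph_def critical_cycle_iff)
  have tails: "fst e' \<in> pverts (critical_graph A)" if "e' \<in> set p" for e'
    using that p(1) by (auto simp: critical_graph_def)
  then show "fst e \<in> pverts (critical_graph A)" using p(3) .
  obtain q r where qr: "p = q @ e # r" using p(3) by (meson split_list)
  then have "pcas (snd e) r u" "pcas u (q @ [e]) (snd e)"
    using p(2) by (auto simp: pcas_append)
  \<comment> \<open>The head of \<open>e\<close> is the tail of its cyclic successor, which the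
    rotation \<open>r @ q @ [e]\<close> puts first; for a loop this is \<open>e\<close>
    itself.\<close>
  then have "snd e = fst (hd (r @ q @ [e]))"
    by (cases r; cases q) auto
  moreover have "hd (r @ q @ [e]) \<in> set p" unfolding qr by (cases r; cases q) auto
  ultimately show "snd e \<in> pverts (critical_graph A)" using tails by simp
qed simp_all

text \<open>For mean 1, a nonempty closed walk lies in the critical graph exactly if its edges have
  weight 1, as it is then a critical cycle itself. So its lengths at \<open>v\<close> are the return
  times of \<open>v\<close>.\<close>

lemma cyclicity_critical_graph:
  "cyclicity (with_proj (critical_graph A)) = return_gcd_lcm"
proof -
  interpret pair_fin_digraph "critical_graph A" by (rule pair_fin_critical_graph)
  have "{length p | p. awalk v p v} = return_times v" if v: "v \<in> recurrent" for v
  proof -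
    have "awalk v p v \<longleftrightarrow> pcas v p v \<and> (\<forall>e\<in>set p. edge_weight A e = 1)" for p
    proof
      assume "awalk v p v"
      then have "pcas v p v" "set p \<subseteq> parcs (critical_graph A)" by (auto simp: awalk_def)
      then show "pcas v p v \<and> (\<forall>e\<in>set p. edge_weight A e = 1)"
        by (auto simp: critical_graph_def critical_cycle_iff)
    next
      assume p: "pcas v p v \<and> (\<forall>e\<in>set p. edge_weight A e = 1)"
      then have "set p \<subseteq> parcs (critical_graph A)"
        by (cases "p = []") (auto simp: critical_graph_def critical_cycle_iff)
      then show "awalk v p v" using p v by (simp add: awalk_def pverts_critical_graph)
    qed
    then show ?thesis by (auto simp: return_times_def luk_power_eq_1_iff)
  qed
  then show ?thesis
    by (simp add: cyclicity_eq_Lcm_closed_walks return_gcd_lcm_def pverts_critical_graph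
        cong: image_cong)
qed

end

end

section \<open>From powers to orbits of vectors\<close>

lemma luk_mult_vec_0:
  assumes "\<forall>i. x $ i \<in> {0..1}"
  shows "luk_mult_vec (0 :: real^'m^'n) x = 0"
proof -
  \<comment> \<open>This rests on \<open>x $ j \<le> 1\<close>.\<close>
  have "luk 0 (x $ j) = 0" for j using assms by (auto simp: luk_def)
  then show ?thesis by (simp add: luk_mult_vec_def vec_eq_iff)
qed

theorem theorem22:
  fixes A :: "real^'n^'n"
  assumes "\<forall>i j. A $ i $ j \<in> {0..1}"
  shows "(\<forall>x :: real^'n. (\<forall>i. x $ i \<in> {0..1}) \<longrightarrow>
            ultimately_periodic (\<lambda>t. luk_mult_vec (luk_power A t) x))
       \<and> ultimately_periodic (\<lambda>t. luk_power A t)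
       \<and> (max_cycle_mean A < 1 \<longrightarrow>
            (\<forall>x :: real^'n. (\<forall>i. x $ i \<in> {0..1}) \<longrightarrow>
               ultimately_zero (\<lambda>t. luk_mult_vec (luk_power A t) x))
          \<and> ultimately_zero (\<lambda>t. luk_power A t))
       \<and> (max_cycle_mean A = 1 \<longrightarrow>
            (\<forall>x :: real^'n. (\<forall>i. x $ i \<in> {0..1}) \<longrightarrow>
               ultimate_period (\<lambda>t. luk_mult_vec (luk_power A t) x)
                 dvd cyclicity (with_proj (critical_graph A)))
          \<and> ultimate_period (\<lambda>t. luk_power A t) = cyclicity (with_proj (critical_graph A)))"
proof -
  interpret unit_matrix A using assms by unfold_locales simp
  define y where "y x t = luk_mult_vec (luk_power A t) x" for x :: "real^'n" and t
  \<comment> \<open>The orbit is an image of the sequence of powers and inherits its periods, though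
    the least one may become smaller; hence divisibility for vectors and equality for
    powers.\<close>
  have period_y: "ultimate_period_of (y x) return_gcd_lcm" for x
    unfolding y_def
    by (rule ultimate_period_of_image[where f = "\<lambda>B. luk_mult_vec B x"])
      (rule ultimate_period_of_luk_power)
  then have "ultimately_periodic (y x)" for x by (auto simp: ultimately_periodic_def)
  moreover have "ultimately_zero (luk_power A)" if "max_cycle_mean A < 1"
    using that by (intro luk_power_ultimately_zero recurrent_empty)
  moreover have "ultimately_zero (y x)"
    if "ultimately_zero (luk_power A)" "\<forall>i. x $ i \<in> {0..1}" for x
    using that luk_mult_vec_0[of x] by (auto simp: ultimately_zero_def y_def)
  moreover have "ultimate_period (y x) dvd return_gcd_lcm" for x
    using period_y by (rule ultimate_period_dvd)
  moreover have "ultimate_period (luk_power A) = return_gcd_lcm"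
    using ultimate_period_dvd[OF ultimate_period_of_luk_power] return_gcd_lcm_dvd_period
      ultimate_period_of_ultimate_period[OF luk_power_ultimately_periodic]
    by (blast intro: dvd_antisym)
  ultimately show ?thesis
    using luk_power_ultimately_periodic cyclicity_critical_graph unfolding y_def by simp
qed

end
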